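(* Let $\|\cdot\|$ be a norm on $\mathbb{R}^d$ (the source norm), and let $\|\cdot\|^{\mathrm{tn}}_{(k)}$ be the associated generalized top-$k$ norms. If $\|\cdot\|$ is orthant-strictly monotonic, then $$\{x\in\mathbb{R}^d : \ell_0(x)\le k\}=\{x\in\mathbb{R}^d : \|x\|=\|x\|^{\mathrm{tn}}_{(k)}\}=\{x\in\mathbb{R}^d : \|x\|\le\|x\|^{\mathrm{tn}}_{(k)}\}\qquad\forall k\in\{0,1,\dots,d\},$$ and $$\ell_0(x)=\min\{k\in\{1,\dots,d\} : \|x\|^{\mathrm{tn}}_{(k)}=\|x\|\}\qquad\forall x\in\mathbb{R}^d.$$
   Context: $d\ge 1$ is an integer. $\ell_0(x)$ is the number of nonzero components of $x\in\mathbb{R}^d$. For $K\subset\{1,\dots,d\}$, $x_K$ is the vector that coincides with $x$ on $K$ and is zero outside $K$. The generalized top-$k$ norm is $\|x\|^{\mathrm{tn}}_{(k)}=\sup\{\|x_K\| : K\subset\{1,\dots,d\},\ |K|\le k\}$ for $k\in\{1,\dots,d\}$; the same formula read at $k=0$ gives $\|x\|^{\mathrm{tn}}_{(0)}=0$. A norm $\|\cdot\|$ is orthant-strictly monotonic if, for all $x,x'\in\mathbb{R}^d$, ($|x_i|\le|x_i'|$ and $x_ix_i'\ge 0$ for all $i$, and $|x_j|<|x'_j|$ for some $j$) implies $\|x\|<\|x'\|$.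
   Formalization: The last formula fails at x = 0, where the minimum over {1,…,d} is 1 but ℓ₀(0) = 0; it is proved with k in {1,…,d} for all x ≠ 0, and with k in {0,1,…,d} for all x. *)

theory Defs
  imports "HOL-Analysis.Analysis"
begin

text \<open>The source norm is an arbitrary norm on \<open>real ^ 'n\<close>, unrelated to the Euclidean
  \<^const>\<open>norm\<close> of that type, so it is represented as a function satisfying the norm axioms.\<close>

definition is_norm :: "('a::real_vector \<Rightarrow> real) \<Rightarrow> bool" where
  "is_norm N \<longleftrightarrow>
     (\<forall>x. 0 \<le> N x) \<and>
     (\<forall>x. N x = 0 \<longleftrightarrow> x = 0) \<and>
     (\<forall>c x. N (c *\<^sub>R x) = \<bar>c\<bar> * N x) \<and>
     (\<forall>x y. N (x + y) \<le> N x + N y)"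

definition orthant_strictly_monotonic :: "(real ^ 'n \<Rightarrow> real) \<Rightarrow> bool" where
  "orthant_strictly_monotonic N \<longleftrightarrow>
     (\<forall>x x'. (\<forall>i. \<bar>x $ i\<bar> \<le> \<bar>x' $ i\<bar> \<and> 0 \<le> x $ i * x' $ i) \<and>
             (\<exists>j. \<bar>x $ j\<bar> < \<bar>x' $ j\<bar>) \<longrightarrow> N x < N x')"

definition l0 :: "real ^ 'n \<Rightarrow> nat" where
  "l0 x = card {i. x $ i \<noteq> 0}"

definition restrict_vec :: "real ^ 'n \<Rightarrow> 'n set \<Rightarrow> real ^ 'n" where
  "restrict_vec x K = (\<chi> i. if i \<in> K then x $ i else 0)"

text \<open>The supremum ranges over a finite nonempty set of reals, also for \<open>k = 0\<close>, where only
  \<open>K = {}\<close> qualifies.\<close>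

definition top_norm :: "(real ^ 'n \<Rightarrow> real) \<Rightarrow> nat \<Rightarrow> real ^ 'n \<Rightarrow> real" where
  "top_norm N k x = (SUP K \<in> {K. card K \<le> k}. N (restrict_vec x K))"

end

theory Submission
  imports Defs
begin

text \<open>Deleting a nonzero component of \<open>x\<close> strictly decreases an orthant-strictly monotonic
  norm, so \<open>N x\<^sub>K \<le> N x\<close>, with equality exactly when \<open>K\<close> contains the support of \<open>x\<close>. The
  supremum defining the top-\<open>k\<close> norm runs over finitely many sets \<open>K\<close> and is attained. Hence
  it always lies below \<open>N x\<close>, and it reaches \<open>N x\<close> iff some \<open>K\<close> with at most \<open>k\<close> elements
  contains the support, that is, iff \<open>l0 x \<le> k\<close>
  (lemmas \<open>top_norm_le\<close> and \<open>le_top_norm_iff\<close>).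
  Both claims of the theorem are read off from this equivalence: for fixed \<open>k\<close> it describes
  the level sets of \<open>l0\<close>, and for fixed \<open>x\<close> it says that the indices \<open>k\<close> with
  \<open>top_norm N k x = N x\<close> form an interval starting at \<open>l0 x\<close>.\<close>

lemma restrict_vec_eq_self_iff: "restrict_vec x K = x \<longleftrightarrow> {i. x $ i \<noteq> 0} \<subseteq> K"
  by (auto simp: restrict_vec_def vec_eq_iff)

lemma restrict_vec_less:
  assumes "orthant_strictly_monotonic N" and "\<not> {i. x $ i \<noteq> 0} \<subseteq> K"
  shows "N (restrict_vec x K) < N x"
proof -
  have "\<forall>i. \<bar>restrict_vec x K $ i\<bar> \<le> \<bar>x $ i\<bar> \<and> 0 \<le> restrict_vec x K $ i * x $ i"
    by (simp add: restrict_vec_def)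
  moreover have "\<exists>j. \<bar>restrict_vec x K $ j\<bar> < \<bar>x $ j\<bar>"
    using assms(2) by (auto simp: restrict_vec_def)
  ultimately show ?thesis
    using assms(1) unfolding orthant_strictly_monotonic_def by blast
qed

lemma restrict_vec_le:
  assumes "orthant_strictly_monotonic N"
  shows "N (restrict_vec x K) \<le> N x"
  using restrict_vec_less[OF assms, of x K] restrict_vec_eq_self_iff[of x K]
  by (cases "{i. x $ i \<noteq> 0} \<subseteq> K") auto

lemma top_norm_upper:
  fixes N :: "real ^ 'n \<Rightarrow> real"
  assumes "card K \<le> k"
  shows "N (restrict_vec x K) \<le> top_norm N k x"
  unfolding top_norm_def using assms by (intro cSUP_upper bdd_above_finite) auto

lemma top_norm_attained:
  fixes N :: "real ^ 'n \<Rightarrow> real"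
  obtains K where "card K \<le> k" and "top_norm N k x = N (restrict_vec x K)"
proof -
  let ?V = "(\<lambda>K. N (restrict_vec x K)) ` {K. card K \<le> k}"
  have "?V \<noteq> {}"
    by (auto intro: exI[of _ "{}"])
  then have "top_norm N k x \<in> ?V"
    unfolding top_norm_def by (simp add: cSup_eq_Max)
  then show ?thesis
    using that by auto
qed

lemma top_norm_le:
  assumes "orthant_strictly_monotonic N"
  shows "top_norm N k x \<le> N x"
  by (metis top_norm_attained restrict_vec_le[OF assms])

text \<open>If \<open>N x\<close> is reached, a maximizing \<open>K\<close> loses no mass and therefore contains the support;
  conversely, the support itself is an admissible choice of \<open>K\<close>.\<close>

lemma le_top_norm_iff:
  assumes "orthant_strictly_monotonic N"
  shows "N x \<le> top_norm N k x \<longleftrightarrow> l0 x \<le> k"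
proof
  assume le: "N x \<le> top_norm N k x"
  obtain K where K: "card K \<le> k" "top_norm N k x = N (restrict_vec x K)"
    by (rule top_norm_attained)
  then have "{i. x $ i \<noteq> 0} \<subseteq> K"
    using le restrict_vec_less[OF assms, of x K] by force
  then show "l0 x \<le> k"
    using K(1) card_mono[of K] unfolding l0_def by (metis finite le_trans)
next
  assume "l0 x \<le> k"
  then show "N x \<le> top_norm N k x"
    using top_norm_upper[of "{i. x $ i \<noteq> 0}" k N x]
      restrict_vec_eq_self_iff[of x "{i. x $ i \<noteq> 0}"]
    by (simp add: l0_def)
qed

lemma top_norm_eq_iff:
  assumes "orthant_strictly_monotonic N"
  shows "top_norm N k x = N x \<longleftrightarrow> l0 x \<le> k"
  using top_norm_le[OF assms] le_top_norm_iff[OF assms] by (metis order_antisym order_refl)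

lemma l0_le_CARD: "l0 (x :: real ^ 'n) \<le> CARD('n)"
  unfolding l0_def by (simp add: card_mono)

lemma l0_pos: "x \<noteq> 0 \<Longrightarrow> 1 \<le> l0 x"
  by (auto simp: l0_def vec_eq_iff Suc_le_eq card_gt_0_iff)

theorem mainTheorem11:
  fixes N :: "real ^ 'n \<Rightarrow> real"
  assumes "is_norm N"
    and "orthant_strictly_monotonic N"
  shows "(\<forall>k \<in> {0..CARD('n)}.
            {x. l0 x \<le> k} = {x. N x = top_norm N k x} \<and>
            {x. N x = top_norm N k x} = {x. N x \<le> top_norm N k x}) \<and>
         (\<forall>x. x \<noteq> 0 \<longrightarrow> l0 x = Min {k \<in> {1..CARD('n)}. top_norm N k x = N x}) \<and>
         (\<forall>x. l0 x = Min {k \<in> {0..CARD('n)}. top_norm N k x = N x})"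
proof (intro conjI ballI allI impI)
  fix k
  show "{x. l0 x \<le> k} = {x. N x = top_norm N k x}"
    using top_norm_eq_iff[OF assms(2)] by (metis (no_types))
  show "{x. N x = top_norm N k x} = {x. N x \<le> top_norm N k x}"
    using top_norm_eq_iff[OF assms(2)] le_top_norm_iff[OF assms(2)] by (metis (no_types))
next
  fix x :: "real ^ 'n"
  assume "x \<noteq> 0"
  then show "l0 x = Min {k \<in> {1..CARD('n)}. top_norm N k x = N x}"
    using l0_le_CARD[of x] l0_pos[of x]
    by (intro Min_eqI[symmetric]) (auto simp: top_norm_eq_iff[OF assms(2)])
next
  fix x :: "real ^ 'n"
  show "l0 x = Min {k \<in> {0..CARD('n)}. top_norm N k x = N x}"
    using l0_le_CARD[of x]
    by (intro Min_eqI[symmetric]) (auto simp: top_norm_eq_iff[OF assms(2)])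
qed

end
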